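(* Let $f:\mathbb{Z}_+\to\mathbb{R}$ be an L-additive function which is not identically zero, and let $a,b\in\mathbb{N}=\{0,1,2,\dots\}$. Then: (i) If $p\in U_f$, then $$\Big(\frac{f(p^{a+1})}{(a+1)f(p)}\Big)^b=\Big(\frac{f(p^{b+1})}{(b+1)f(p)}\Big)^a.$$ (ii) If $p,q\in U_f$, then $$f(p^aq^b)=\frac{f(p^a)f(q^{b+1})}{(b+1)f(q)}+\frac{f(q^b)f(p^{a+1})}{(a+1)f(p)}.$$ (iii) If $p\in V_f$ and $q_1,q_2\in U_f$, then $$\frac{f(pq_1)}{f(pq_2)}=\frac{f(q_1)}{f(q_2)}\neq 0.$$ (iv) If $p\in U_f$, then $f(p^2)\neq 0$.
   Context: $\mathbb{P}$ is the set of primes. An arithmetic function $h$ is completely multiplicative if $h(1)=1$ and $h(mn)=h(m)h(n)$ for all $m,n\in\mathbb{Z}_+$. An arithmetic function $f$ is L-additive if there is a nonzero-valued completely multiplicative function $h_f$ such that $f(mn)=f(m)h_f(n)+f(n)h_f(m)$ for all $m,n\in\mathbb{Z}_+$. $U_f=\{p\in\mathbb{P}: f(p)\neq 0\}$ and $V_f=\{p\in\mathbb{P}: f(p)=0\}$. *)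

theory Defs
  imports Complex_Main "HOL-Computational_Algebra.Primes"
begin

text \<open>
  Functions on the positive integers are represented by functions of type \<^typ>\<open>nat \<Rightarrow> real\<close>
  whose value at \<open>0\<close> is irrelevant; all conditions are therefore restricted to positive arguments.
\<close>

definition completely_multiplicative :: "(nat \<Rightarrow> real) \<Rightarrow> bool" where
  "completely_multiplicative h \<longleftrightarrow>
     h 1 = 1 \<and> (\<forall>m>0. \<forall>n>0. h (m * n) = h m * h n)"

definition L_additive :: "(nat \<Rightarrow> real) \<Rightarrow> bool" where
  "L_additive f \<longleftrightarrow>
     (\<exists>h. completely_multiplicative h \<and> (\<forall>n>0. h n \<noteq> 0) \<and>
          (\<forall>m>0. \<forall>n>0. f (m * n) = f m * h n + f n * h m))"

definition U :: "(nat \<Rightarrow> real) \<Rightarrow> nat set" where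
  "U f = {p. prime p \<and> f p \<noteq> 0}"

definition V :: "(nat \<Rightarrow> real) \<Rightarrow> nat set" where
  "V f = {p. prime p \<and> f p = 0}"

end

theory Submission
  imports Defs
begin

text \<open>
  If \<open>h\<close> is the multiplicative companion of \<open>f\<close>, then \<open>f (p ^ (n + 1)) = (n + 1) f(p) h(p) ^ n\<close>. Hence
  the normalised quotients in the theorem are powers of \<open>h(p)\<close>, and every claim reduces to the
  product rule of \<open>f\<close>.
\<close>

lemma completely_multiplicative_power:
  assumes "completely_multiplicative h" "p > 0"
  shows "h (p ^ n) = h p ^ n"
  using assms by (induction n) (auto simp: completely_multiplicative_def)

text \<open>Splitting off one factor \<open>p\<close> by the product rule multiplies the previous
  value by \<open>h p\<close> and adds one more copy of \<open>f p * h p ^ Suc n\<close>. Indexing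
  by \<open>Suc n\<close> avoids truncated subtraction in the exponent of
  \<open>h p\<close>.\<close>

lemma L_additive_power_Suc:
  assumes h: "completely_multiplicative h"
    and f: "\<And>m n. m > 0 \<Longrightarrow> n > 0 \<Longrightarrow> f (m * n) = f m * h n + f n * h m"
    and p: "p > 0"
  shows "f (p ^ Suc n) = real (Suc n) * f p * h p ^ n"
proof (induction n)
  case (Suc n)
  have "f (p ^ Suc (Suc n)) = f p * h (p ^ Suc n) + f (p ^ Suc n) * h p"
    using f[of p "p ^ Suc n"] p by simp
  then show ?case
    using Suc completely_multiplicative_power[OF h p, of "Suc n"] by (simp add: algebra_simps)
qed simp

theorem theorem10:
  fixes f :: "nat \<Rightarrow> real" and a b :: nat
  assumes "L_additive f"
    and "\<exists>n>0. f n \<noteq> 0"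
  shows "(\<forall>p\<in>U f.
            (f (p ^ (a + 1)) / (real (a + 1) * f p)) ^ b
          = (f (p ^ (b + 1)) / (real (b + 1) * f p)) ^ a)
       \<and> (\<forall>p\<in>U f. \<forall>q\<in>U f.
            f (p ^ a * q ^ b)
          = f (p ^ a) * f (q ^ (b + 1)) / (real (b + 1) * f q)
            + f (q ^ b) * f (p ^ (a + 1)) / (real (a + 1) * f p))
       \<and> (\<forall>p\<in>V f. \<forall>q\<^sub>1\<in>U f. \<forall>q\<^sub>2\<in>U f.
            f (p * q\<^sub>1) / f (p * q\<^sub>2) = f q\<^sub>1 / f q\<^sub>2 \<and> f q\<^sub>1 / f q\<^sub>2 \<noteq> 0)
       \<and> (\<forall>p\<in>U f. f (p ^ 2) \<noteq> 0)"
proof -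
  obtain h where h: "completely_multiplicative h"
    and nz: "\<And>n. n > 0 \<Longrightarrow> h n \<noteq> 0"
    and mult: "\<And>m n. m > 0 \<Longrightarrow> n > 0 \<Longrightarrow> f (m * n) = f m * h n + f n * h m"
    using assms(1) unfolding L_additive_def by blast
  have pos: "p > 0" if "p \<in> U f \<union> V f" for p
    using that by (auto simp: U_def V_def prime_gt_0_nat)
  \<comment> \<open>Membership in \<open>U f\<close> gives \<open>f p \<noteq> 0\<close>, so
    \<open>real (n + 1) * f p\<close> cancels from the power formula.\<close>
  have quot: "f (p ^ (n + 1)) / (real (n + 1) * f p) = h p ^ n" if "p \<in> U f" for p n
    using that L_additive_power_Suc[OF h mult, of p n] pos[of p] by (simp add: U_def)
  have i: "(f (p ^ (a + 1)) / (real (a + 1) * f p)) ^ b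
      = (f (p ^ (b + 1)) / (real (b + 1) * f p)) ^ a" if "p \<in> U f" for p
    \<comment> \<open>Both sides have become \<open>h p ^ (a * b)\<close>.\<close>
    unfolding quot[OF that] by (simp add: mult.commute flip: power_mult)
  have ii: "f (p ^ a * q ^ b) = f (p ^ a) * f (q ^ (b + 1)) / (real (b + 1) * f q)
      + f (q ^ b) * f (p ^ (a + 1)) / (real (a + 1) * f p)" if "p \<in> U f" "q \<in> U f" for p q
  proof -
    \<comment> \<open>The product rule for the factors \<open>p ^ a\<close> and
      \<open>q ^ b\<close>; it needs no coprimality, so \<open>p = q\<close> is covered. Reading
      \<open>quot\<close> backwards then eliminates \<open>h\<close>.\<close>
    have "f (p ^ a * q ^ b) = f (p ^ a) * h q ^ b + f (q ^ b) * h p ^ a"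
      using that pos mult completely_multiplicative_power[OF h] by simp
    then show ?thesis
      using quot that by (metis times_divide_eq_right)
  qed
  have iii: "f (p * q1) / f (p * q2) = f q1 / f q2 \<and> f q1 / f q2 \<noteq> 0"
    if "p \<in> V f" "q1 \<in> U f" "q2 \<in> U f" for p q1 q2
  proof -
    \<comment> \<open>Since \<open>f p = 0\<close>, one summand of the product rule vanishes; the
      common factor \<open>h p \<noteq> 0\<close> then cancels in the quotient.\<close>
    have "f (p * q) = f q * h p" if "q \<in> U f" for q
      using mult[of p q] pos \<open>p \<in> V f\<close> that by (simp add: V_def)
    moreover have "h p \<noteq> 0"
      using nz pos that by simp
    ultimately show ?thesis
      using that by (simp add: U_def)
  qed
  \<comment> \<open>The power formula at exponent 2 reads \<open>2 * f p * h p\<close>, a product of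
    nonzero factors.\<close>
  have iv: "f (p ^ 2) \<noteq> 0" if "p \<in> U f" for p
    using L_additive_power_Suc[OF h mult, of p 1] nz[of p] pos[of p] that
    by (simp add: U_def power2_eq_square)
  show ?thesis
    using i ii iii iv by blast
qed

end
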